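(* Consider an arbitrage-free zero coupon bond market in discrete or continuous time, with bond prices $P(t,T)$ ($0\le t\le T$), as described in the context. Let $t\ge s\ge 0$ be time points for which the almost sure limits $$x_L(t)=\lim_{T\to\infty}P(t,T)^{\frac1T}\qquad\text{and}\qquad x_L(s)=\lim_{T\to\infty}P(s,T)^{\frac1T}$$ exist, and suppose that the corresponding long zero coupon rates $z_L(t)$ and $z_L(s)$ are almost surely finite random variables. Then $$x_L(s)\ge x_L(t)\quad\text{a.s.}$$
   Context: Setting. Let $(\Omega,\mathcal F,\mathbb P)$ be a probability space with a filtration $(\mathcal F_t)_{t\ge 0}$, where the time parameter is either discrete ($t\in\mathbb N=\{0,1,2,\dots\}$) or continuous ($t\in\mathbb R_{\ge 0}$); the usual conditions are not assumed. All maturities $T$ and limits $T\to\infty$ are taken in the same time set. For each $T$, the price process $(P(t,T))_{0\le t\le T}$ of the default-free zero coupon bond with maturity $T$ is a strictly positive semimartingale with respect to $(\mathcal F_t)_{0\le t\le T}$, with $P(T,T)=1$. No-arbitrage assumption. There exist a probability measure $Q$ on $(\Omega,\mathcal F)$ and an $(\mathcal F_t)_{t\ge0}$-adapted interest rate process $(R_t)_{t\ge 0}$ (rates may be negative) such that: (1) the process $B$ defined by $B_t=\prod_{i=0}^{t-1}(1+R_i)$ in the discrete case, and by $B_t=\exp\left(\int_0^t R_u\,du\right)$ in the continuous case, is well defined, predictable and strictly positive, and $B_t/B_{t+h}$ is $Q$-integrable for all $t\ge0$, $h\ge 0$; (2) $Q$ is locally equivalent to $\mathbb P$, i.e. $Q|_{\mathcal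 F_t}\sim \mathbb P|_{\mathcal F_t}$ for every $t\ge0$; (3) for each $T$, the discounted price process $(B_t^{-1}P(t,T))_{0\le t\le T}$ is a $Q$-martingale. Consequently $P(t,T)=E_Q\left(\frac{B_t}{B_T}\,\middle|\,\mathcal F_t\right)$ for $t\le T$. Rates. In the discrete case the forward rate $f(t,T)$ is defined by $P(t,T)=(1+f(t,T))P(t,T+1)$ and the zero coupon rate $z(t,T)$ by $P(t,T)=(1+z(t,T))^{-(T-t)}$ for $t<T$. In the continuous case the forward rate $f(t,\cdot)$ is assumed to exist as an adapted process with $P(t,T)=\exp\left(-\int_t^T f(t,u)\,du\right)$, and the zero coupon rate (yield) is $z(t,T)=\frac1{T-t}\int_t^T f(t,u)\,du$ for $t<T$. The long zero coupon rate is the almost sure limit $z_L(t)=\lim_{T\to\infty}z(t,T)$. Its almost sure existence is equivalent to that of $x_L(t)=\lim_{T\to\infty}P(t,T)^{1/T}$, with $z_L(t)=\frac1{x_L(t)}-1$ in the discrete case and $z_L(t)=-\ln x_L(t)$ in the continuous case. *)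

theory Defs
  imports "HOL-Probability.Probability"
begin

section \<open>Time sets\<close>

text \<open>
  Both kinds of time are embedded into the reals; processes are functions
  \<^typ>\<open>real \<Rightarrow> 'a \<Rightarrow> real\<close> of which only the values at times in the time set matter.
  The notions below are relative to an index set \<^term>\<open>I :: real set\<close>, which will be the time set
  or an initial segment of it.
\<close>

datatype time_kind = Discrete | Continuous

fun time_set :: "time_kind \<Rightarrow> real set" where
  "time_set Discrete = \<nat>"
| "time_set Continuous = {0..}"

definition maturities_to_infinity :: "time_kind \<Rightarrow> real filter" where
  "maturities_to_infinity k = inf at_top (principal (time_set k))"


section \<open>Filtrations, martingales and semimartingales\<close>

text \<open>No completeness or right-continuity is required of a filtration.\<close>

definition filtration_on :: "'a measure \<Rightarrow> real set \<Rightarrow> (real \<Rightarrow> 'a measure) \<Rightarrow> bool" where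
  "filtration_on M I F \<longleftrightarrow>
     (\<forall>t\<in>I. subalgebra M (F t)) \<and> (\<forall>s\<in>I. \<forall>t\<in>I. s \<le> t \<longrightarrow> sets (F s) \<subseteq> sets (F t))"

definition adapted_on :: "real set \<Rightarrow> (real \<Rightarrow> 'a measure) \<Rightarrow> (real \<Rightarrow> 'a \<Rightarrow> real) \<Rightarrow> bool" where
  "adapted_on I F X \<longleftrightarrow> (\<forall>t\<in>I. X t \<in> borel_measurable (F t))"

definition martingale_on ::
  "'a measure \<Rightarrow> real set \<Rightarrow> (real \<Rightarrow> 'a measure) \<Rightarrow> (real \<Rightarrow> 'a \<Rightarrow> real) \<Rightarrow> bool" where
  "martingale_on M I F X \<longleftrightarrow>
     adapted_on I F X \<and> (\<forall>t\<in>I. integrable M (X t)) \<and>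
     (\<forall>s\<in>I. \<forall>t\<in>I. s \<le> t \<longrightarrow> (AE \<omega> in M. real_cond_exp M (F s) (X t) \<omega> = X s \<omega>))"

text \<open>
  In discrete time the filters \<^term>\<open>at t within I \<inter> {t<..}\<close> and \<^term>\<open>at t within I \<inter> {..<t}\<close> are
  trivial, so that every process has cadlag paths.
\<close>

definition cadlag_on :: "'a measure \<Rightarrow> real set \<Rightarrow> (real \<Rightarrow> 'a \<Rightarrow> real) \<Rightarrow> bool" where
  "cadlag_on M I X \<longleftrightarrow>
     (\<forall>\<omega>\<in>space M. \<forall>t\<in>I.
        ((\<lambda>u. X u \<omega>) \<longlongrightarrow> X t \<omega>) (at t within I \<inter> {t<..}) \<and>
        (\<exists>l. ((\<lambda>u. X u \<omega>) \<longlongrightarrow> l) (at t within I \<inter> {..<t})))"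

definition finite_variation_on :: "'a measure \<Rightarrow> real set \<Rightarrow> (real \<Rightarrow> 'a \<Rightarrow> real) \<Rightarrow> bool" where
  "finite_variation_on M I X \<longleftrightarrow>
     (\<forall>\<omega>\<in>space M. \<forall>t\<in>I. \<exists>C. \<forall>(n::nat) p. mono p \<and> range p \<subseteq> I \<inter> {..t} \<longrightarrow>
        (\<Sum>i<n. \<bar>X (p (Suc i)) \<omega> - X (p i) \<omega>\<bar>) \<le> C)"

definition stopping_time_on ::
  "'a measure \<Rightarrow> real set \<Rightarrow> (real \<Rightarrow> 'a measure) \<Rightarrow> ('a \<Rightarrow> ereal) \<Rightarrow> bool" where
  "stopping_time_on M I F \<tau> \<longleftrightarrow>
     (\<forall>\<omega>\<in>space M. \<tau> \<omega> \<in> ereal ` I \<union> {\<infinity>}) \<and>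
     (\<forall>t\<in>I. {\<omega> \<in> space M. \<tau> \<omega> \<le> ereal t} \<in> sets (F t))"

definition stopped_process ::
  "(real \<Rightarrow> 'a \<Rightarrow> real) \<Rightarrow> ('a \<Rightarrow> ereal) \<Rightarrow> real \<Rightarrow> 'a \<Rightarrow> real" where
  "stopped_process X \<tau> t \<omega> = X (real_of_ereal (min (ereal t) (\<tau> \<omega>))) \<omega>"

text \<open>
  The localizing sequence has to exhaust the index set: for \<^term>\<open>I = {0..}\<close> or \<^term>\<open>I = \<nat>\<close> the
  condition says that it tends to infinity, on an index set with last element \<^term>\<open>T\<close> that it
  eventually reaches \<^term>\<open>T\<close>.
\<close>

definition local_martingale_on ::
  "'a measure \<Rightarrow> real set \<Rightarrow> (real \<Rightarrow> 'a measure) \<Rightarrow> (real \<Rightarrow> 'a \<Rightarrow> real) \<Rightarrow> bool" where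
  "local_martingale_on M I F X \<longleftrightarrow>
     adapted_on I F X \<and> cadlag_on M I X \<and>
     (\<exists>\<tau> :: nat \<Rightarrow> 'a \<Rightarrow> ereal.
        (\<forall>n. stopping_time_on M I F (\<tau> n)) \<and>
        (AE \<omega> in M. incseq (\<lambda>n. \<tau> n \<omega>)) \<and>
        (AE \<omega> in M. \<forall>t\<in>I. \<forall>\<^sub>F n in sequentially. ereal t \<le> \<tau> n \<omega>) \<and>
        (\<forall>n. martingale_on M I F (stopped_process X (\<tau> n))))"

definition semimartingale_on ::
  "'a measure \<Rightarrow> real set \<Rightarrow> (real \<Rightarrow> 'a measure) \<Rightarrow> (real \<Rightarrow> 'a \<Rightarrow> real) \<Rightarrow> bool" where
  "semimartingale_on M I F X \<longleftrightarrow>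
     adapted_on I F X \<and>
     (\<exists>N A. local_martingale_on M I F N \<and>
        adapted_on I F A \<and> cadlag_on M I A \<and> finite_variation_on M I A \<and>
        (\<forall>\<omega>\<in>space M. N 0 \<omega> = 0 \<and> A 0 \<omega> = 0 \<and> (\<forall>t\<in>I. X t \<omega> = X 0 \<omega> + N t \<omega> + A t \<omega>)))"

text \<open>
  For \<^term>\<open>I = \<nat>\<close> predictability means that the value at \<^term>\<open>t + 1\<close> is measurable with respect
  to \<^term>\<open>F t\<close> and the value at \<^term>\<open>0\<close> with respect to \<^term>\<open>F 0\<close>.
\<close>

definition predictable_algebra ::
  "'a measure \<Rightarrow> real set \<Rightarrow> (real \<Rightarrow> 'a measure) \<Rightarrow> (real \<times> 'a) measure" where
  "predictable_algebra M I F = sigma (I \<times> space M)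
     ({{0} \<times> A | A. A \<in> sets (F 0)} \<union>
      {(I \<inter> {s<..t}) \<times> A | s t A. s \<in> I \<and> t \<in> I \<and> s < t \<and> A \<in> sets (F s)})"

definition predictable_on ::
  "'a measure \<Rightarrow> real set \<Rightarrow> (real \<Rightarrow> 'a measure) \<Rightarrow> (real \<Rightarrow> 'a \<Rightarrow> real) \<Rightarrow> bool" where
  "predictable_on M I F X \<longleftrightarrow>
     (\<lambda>(t, \<omega>). X t \<omega>) \<in> borel_measurable (predictable_algebra M I F)"

definition locally_equivalent ::
  "real set \<Rightarrow> (real \<Rightarrow> 'a measure) \<Rightarrow> 'a measure \<Rightarrow> 'a measure \<Rightarrow> bool" where
  "locally_equivalent I F Q M \<longleftrightarrow>
     (\<forall>t\<in>I. absolutely_continuous (restr_to_subalg M (F t)) (restr_to_subalg Q (F t)) \<and>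
            absolutely_continuous (restr_to_subalg Q (F t)) (restr_to_subalg M (F t)))"

text \<open>
  Limits are taken in the extended reals, so that an infinite limit is a possible value; finiteness
  is a separate condition.
\<close>

definition almost_sure_limit ::
  "'a measure \<Rightarrow> time_kind \<Rightarrow> (real \<Rightarrow> 'a \<Rightarrow> real) \<Rightarrow> ('a \<Rightarrow> ereal) \<Rightarrow> bool" where
  "almost_sure_limit M k X L \<longleftrightarrow>
     (AE \<omega> in M. ((\<lambda>T. ereal (X T \<omega>)) \<longlongrightarrow> L \<omega>) (maturities_to_infinity k))"


section \<open>Bond prices and rates\<close>

text \<open>
  The arguments of \<^term>\<open>P :: real \<Rightarrow> real \<Rightarrow> 'a \<Rightarrow> real\<close> (and likewise of the rates) are the
  present time and the maturity.
\<close>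

fun forward_rate ::
  "'a measure \<Rightarrow> time_kind \<Rightarrow> (real \<Rightarrow> 'a measure) \<Rightarrow> (real \<Rightarrow> real \<Rightarrow> 'a \<Rightarrow> real) \<Rightarrow>
   (real \<Rightarrow> real \<Rightarrow> 'a \<Rightarrow> real) \<Rightarrow> bool" where
  "forward_rate M Discrete F P f \<longleftrightarrow>
     (\<forall>t\<in>\<nat>. \<forall>T\<in>\<nat>. t \<le> T \<longrightarrow>
        (\<forall>\<omega>\<in>space M. P t T \<omega> = (1 + f t T \<omega>) * P t (T + 1) \<omega>))"
| "forward_rate M Continuous F P f \<longleftrightarrow>
     (\<forall>T\<ge>0. adapted_on {0..T} F (\<lambda>t. f t T)) \<and>
     (\<forall>t\<ge>0. \<forall>T\<ge>t. \<forall>\<omega>\<in>space M.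
        set_integrable lborel {t..T} (\<lambda>u. f t u \<omega>) \<and>
        P t T \<omega> = exp (- (LINT u:{t..T}|lborel. f t u \<omega>)))"

text \<open>
  In discrete time the price determines the growth factor \<open>1 + z t T\<close> only up to sign when
  \<open>T - t\<close> is even; the positive one is meant.
\<close>

fun zero_coupon_rate ::
  "'a measure \<Rightarrow> time_kind \<Rightarrow> (real \<Rightarrow> real \<Rightarrow> 'a \<Rightarrow> real) \<Rightarrow>
   (real \<Rightarrow> real \<Rightarrow> 'a \<Rightarrow> real) \<Rightarrow> (real \<Rightarrow> real \<Rightarrow> 'a \<Rightarrow> real) \<Rightarrow> bool" where
  "zero_coupon_rate M Discrete P f z \<longleftrightarrow>
     (\<forall>t\<in>\<nat>. \<forall>T\<in>\<nat>. t < T \<longrightarrow>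
        (\<forall>\<omega>\<in>space M. 1 + z t T \<omega> > 0 \<and> P t T \<omega> = (1 + z t T \<omega>) powr (- (T - t))))"
| "zero_coupon_rate M Continuous P f z \<longleftrightarrow>
     (\<forall>t\<ge>0. \<forall>T>t. \<forall>\<omega>\<in>space M.
        z t T \<omega> = 1 / (T - t) * (LINT u:{t..T}|lborel. f t u \<omega>))"

locale zero_coupon_bond_market = prob_space M
  for M :: "'a measure" +
  fixes k :: time_kind
    and F :: "real \<Rightarrow> 'a measure"
    and P :: "real \<Rightarrow> real \<Rightarrow> 'a \<Rightarrow> real"
    and f :: "real \<Rightarrow> real \<Rightarrow> 'a \<Rightarrow> real"
    and z :: "real \<Rightarrow> real \<Rightarrow> 'a \<Rightarrow> real"
  assumes filtration: "filtration_on M (time_set k) F"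
    and price_semimartingale:
      "T \<in> time_set k \<Longrightarrow> semimartingale_on M (time_set k \<inter> {0..T}) F (\<lambda>t. P t T)"
    and price_pos:
      "T \<in> time_set k \<Longrightarrow> t \<in> time_set k \<Longrightarrow> t \<le> T \<Longrightarrow> \<omega> \<in> space M \<Longrightarrow> P t T \<omega> > 0"
    and price_at_maturity: "T \<in> time_set k \<Longrightarrow> \<omega> \<in> space M \<Longrightarrow> P T T \<omega> = 1"
    and forward_rate: "forward_rate M k F P f"
    and zero_coupon_rate: "zero_coupon_rate M k P f z"


section \<open>Absence of arbitrage\<close>

fun bank_account :: "time_kind \<Rightarrow> (real \<Rightarrow> 'a \<Rightarrow> real) \<Rightarrow> real \<Rightarrow> 'a \<Rightarrow> real" where
  "bank_account Discrete R t \<omega> = (\<Prod>i<nat \<lfloor>t\<rfloor>. 1 + R (real i) \<omega>)"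
| "bank_account Continuous R t \<omega> = exp (LINT u:{0..t}|lborel. R u \<omega>)"

text \<open>The Bochner integral has the value 0 where it does not exist; this case is excluded here.\<close>

fun bank_account_well_defined ::
  "'a measure \<Rightarrow> time_kind \<Rightarrow> (real \<Rightarrow> 'a \<Rightarrow> real) \<Rightarrow> bool" where
  "bank_account_well_defined M Discrete R \<longleftrightarrow> True"
| "bank_account_well_defined M Continuous R \<longleftrightarrow>
     (\<forall>t\<ge>0. \<forall>\<omega>\<in>space M. set_integrable lborel {0..t} (\<lambda>u. R u \<omega>))"

definition arbitrage_free ::
  "'a measure \<Rightarrow> time_kind \<Rightarrow> (real \<Rightarrow> 'a measure) \<Rightarrow> (real \<Rightarrow> real \<Rightarrow> 'a \<Rightarrow> real) \<Rightarrow> bool" where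
  "arbitrage_free M k F P \<longleftrightarrow>
     (\<exists>Q R. let I = time_set k; B = bank_account k R in
        prob_space Q \<and> sets Q = sets M \<and>
        adapted_on I F R \<and>
        bank_account_well_defined M k R \<and>
        predictable_on M I F B \<and>
        (\<forall>t\<in>I. \<forall>\<omega>\<in>space M. B t \<omega> > 0) \<and>
        (\<forall>t\<in>I. \<forall>h\<in>I. integrable Q (\<lambda>\<omega>. B t \<omega> / B (t + h) \<omega>)) \<and>
        locally_equivalent I F Q M \<and>
        (\<forall>T\<in>I. martingale_on Q (I \<inter> {0..T}) F (\<lambda>t \<omega>. inverse (B t \<omega>) * P t T \<omega>)))"

end

theory Submission
  imports Defs
begin

text \<open>
  Under the martingale measure \<open>Q\<close> the discounted price \<open>P s n / B s\<close> is the conditional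
  expectation of \<open>P t n / B t\<close> given the information at time \<open>s\<close>. The discount factors
  do not depend on the maturity \<open>n\<close>, so they do not affect the exponential growth rates
  \<open>x\<^sub>L s\<close> and \<open>x\<^sub>L t\<close> in \<open>n\<close>. The theorem is therefore an instance of a fact about
  nonnegative random variables: almost surely, they do not grow faster, on the exponential scale,
  than their conditional expectations (lemma \<open>cond_exp_growth_bound\<close>). On the event that the
  conditional expectations are at most \<open>q ^ n\<close> from some index on, which is known at time \<open>s\<close>,
  Markov's inequality bounds the probability that the variable exceeds \<open>p ^ n\<close> by \<open>(q / p) ^ n\<close>,
  and for \<open>p > q\<close> the Borel--Cantelli lemma applies.

  The exceptional event for fixed \<open>q\<close> and \<open>p\<close> is known at time \<open>t\<close>, so local equivalence is
  enough to make it null under the original measure as well (lemma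
  \<open>AE_transfer_locally_equivalent\<close>). Only countably many exceptional events are needed, because
  rational \<open>q < p\<close> can be placed between any two different growth rates. Integer maturities
  suffice in both kinds of time, since the limits over all maturities are assumed to exist.
\<close>

text \<open>
  The restriction to an event of \<open>F\<close> is what makes Markov's inequality useful here: the integrals
  of \<open>X n\<close> and of \<open>Y n\<close> over such an event agree, and there \<open>Y n\<close> is at most \<open>q ^ n\<close>.
\<close>

lemma (in finite_measure_subalgebra) cond_exp_growth_bound:
  fixes X Y :: "nat \<Rightarrow> 'a \<Rightarrow> real" and p q :: real
  assumes X_int: "\<And>n. n \<ge> N \<Longrightarrow> integrable M (X n)"
    and X_nonneg: "\<And>n \<omega>. n \<ge> N \<Longrightarrow> \<omega> \<in> space M \<Longrightarrow> 0 \<le> X n \<omega>"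
    and Y_meas: "\<And>n. n \<ge> N \<Longrightarrow> Y n \<in> borel_measurable F"
    and Y_cond: "\<And>n. n \<ge> N \<Longrightarrow> AE \<omega> in M. real_cond_exp M F (X n) \<omega> = Y n \<omega>"
    and "0 < q" "q < p"
  shows "AE \<omega> in M. (\<forall>n\<ge>N. Y n \<omega> \<le> q ^ n) \<longrightarrow> (\<forall>\<^sub>F n in sequentially. X n \<omega> \<le> p ^ n)"
proof -
  define A where "A = {\<omega> \<in> space F. \<forall>n\<in>{N..}. Y n \<omega> \<le> q ^ n}"
  have space_F: "space F = space M"
    using subalg by (simp add: subalgebra_def)
  have A_F: "A \<in> sets F"
    unfolding A_def using Y_meas by measurable
  then have A_M[measurable]: "A \<in> sets M"
    using subalg by (auto simp: subalgebra_def)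
  define U where "U n \<omega> = indicator A \<omega> * X n \<omega>" for n \<omega>
  define E where "E n = {\<omega> \<in> space M. U (n + N) \<omega> \<ge> p ^ (n + N)}" for n
  have U_int: "integrable M (U n)" if "n \<ge> N" for n
    unfolding U_def using integrable_mult_indicator[OF A_M X_int[OF that]] by simp
  have U_le: "(\<integral>\<omega>. U n \<omega> \<partial>M) \<le> measure M (space M) * q ^ n" if n: "n \<ge> N" for n
  proof -
    have [measurable]: "Y n \<in> borel_measurable M"
      using measurable_from_subalg[OF subalg Y_meas[OF n]] .
    have "(\<integral>\<omega>. U n \<omega> \<partial>M) = (\<integral>\<omega>\<in>A. X n \<omega> \<partial>M)"
      by (simp add: U_def set_lebesgue_integral_def)
    also have "\<dots> = (\<integral>\<omega>\<in>A. real_cond_exp M F (X n) \<omega> \<partial>M)"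
      by (rule real_cond_exp_intA[OF X_int[OF n] A_F])
    also have "\<dots> \<le> (\<integral>\<omega>. q ^ n \<partial>M)"
      unfolding set_lebesgue_integral_def
    proof (rule integral_mono_AE)
      show "integrable M (\<lambda>\<omega>. indicat_real A \<omega> *\<^sub>R real_cond_exp M F (X n) \<omega>)"
        by (rule integrable_mult_indicator[OF A_M real_cond_exp_int(1)[OF X_int[OF n]]])
      show "AE \<omega> in M. indicat_real A \<omega> *\<^sub>R real_cond_exp M F (X n) \<omega> \<le> q ^ n"
        using Y_cond[OF n]
        by eventually_elim (use n \<open>0 < q\<close> in \<open>auto simp: A_def indicator_def\<close>)
    qed simp
    finally show ?thesis by simp
  qed
  have E_le: "measure M (E n) \<le> measure M (space M) * (q / p) ^ (n + N)" for n
  proof -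
    have "measure M (E n) \<le> (\<integral>\<omega>. U (n + N) \<omega> \<partial>M) / p ^ (n + N)"
      unfolding E_def
    proof (rule integral_Markov_inequality_measure)
      show "AE \<omega> in M. 0 \<le> U (n + N) \<omega>"
        by (rule AE_I2) (simp add: U_def X_nonneg)
    qed (use \<open>0 < q\<close> \<open>q < p\<close> U_int in auto)
    also have "\<dots> \<le> measure M (space M) * q ^ (n + N) / p ^ (n + N)"
      using \<open>0 < q\<close> \<open>q < p\<close> by (intro divide_right_mono U_le) auto
    finally show ?thesis by (simp add: power_divide)
  qed
  have "summable (\<lambda>n. measure M (space M) * (q / p) ^ (n + N))"
    unfolding power_add using \<open>0 < q\<close> \<open>q < p\<close>
    by (intro summable_mult summable_mult2 summable_geometric) auto
  then have "summable (\<lambda>n. measure M (E n))"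
    by (rule summable_comparison_test'[where N = 0]) (simp add: E_le)
  moreover have "E n \<in> sets M" for n
  proof -
    have [measurable]: "U (n + N) \<in> borel_measurable M"
      using U_int[of "n + N"] by auto
    show ?thesis unfolding E_def by measurable
  qed
  ultimately have "AE \<omega> in M. \<forall>\<^sub>F n in sequentially. \<omega> \<in> space M - E n"
    by (intro borel_cantelli_AE1) (auto simp: emeasure_eq_measure)
  then show ?thesis
  proof (rule AE_mp, intro AE_I2 impI)
    fix \<omega>
    assume \<omega>: "\<omega> \<in> space M" and ev: "\<forall>\<^sub>F n in sequentially. \<omega> \<in> space M - E n"
      and Y_le: "\<forall>n\<ge>N. Y n \<omega> \<le> q ^ n"
    have "\<omega> \<in> A" using \<omega> Y_le by (simp add: A_def space_F)
    with ev have "\<forall>\<^sub>F n in sequentially. X (n + N) \<omega> \<le> p ^ (n + N)"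
      by (auto simp: E_def U_def elim!: eventually_mono)
    then show "\<forall>\<^sub>F n in sequentially. X n \<omega> \<le> p ^ n"
      by (rule eventually_sequentially_seg[THEN iffD1])
  qed
qed

lemma AE_transfer_locally_equivalent:
  assumes "locally_equivalent I F Q M" "t \<in> I"
    and Q: "subalgebra Q (F t)" and M: "subalgebra M (F t)"
    and meas: "Measurable.pred (F t) R" and AE: "AE \<omega> in Q. R \<omega>"
  shows "AE \<omega> in M. R \<omega>"
proof (rule AE_restr_to_subalg[OF M], rule absolutely_continuous_AE)
  show "sets (restr_to_subalg M (F t)) = sets (restr_to_subalg Q (F t))"
    by (simp add: sets_restr_to_subalg[OF Q] sets_restr_to_subalg[OF M])
  show "absolutely_continuous (restr_to_subalg Q (F t)) (restr_to_subalg M (F t))"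
    using assms(1,2) by (simp add: locally_equivalent_def)
  show "AE \<omega> in restr_to_subalg Q (F t). R \<omega>"
    by (rule AE_restr_to_subalg2[OF Q AE meas])
qed

lemma eventually_scaled_power_le:
  fixes b c q :: real
  assumes "0 \<le> c" "c < q"
  shows "\<forall>\<^sub>F n in sequentially. b * c ^ n \<le> q ^ n"
proof -
  have "(\<lambda>n. b * (c / q) ^ n) \<longlonglongrightarrow> b * 0"
    using assms by (intro tendsto_mult tendsto_const LIMSEQ_power_zero) auto
  then have "\<forall>\<^sub>F n in sequentially. b * (c / q) ^ n < 1"
    by (rule order_tendstoD(2)) simp
  then show ?thesis
    by eventually_elim (use assms in \<open>simp add: power_divide field_simps\<close>)
qed

lemma filterlim_real_maturities_to_infinity:
  "filterlim real (maturities_to_infinity k) sequentially"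
  unfolding maturities_to_infinity_def filterlim_inf filterlim_principal
  using filterlim_real_sequentially by (cases k) auto

text \<open>
  The rational bounds \<open>q < p\<close> separate the two growth rates; constant positive factors \<open>a\<close> and
  \<open>b\<close> are absorbed by the room left between the bounds and the rates.
\<close>

lemma growth_rate_le:
  fixes u v :: "nat \<Rightarrow> real" and x y :: ereal and a b :: real
  assumes u: "(\<lambda>n. ereal (u n powr (1 / real n))) \<longlonglongrightarrow> x"
    and v: "(\<lambda>n. ereal (v n powr (1 / real n))) \<longlonglongrightarrow> y"
    and pos: "\<forall>\<^sub>F n in sequentially. 0 < u n" "\<forall>\<^sub>F n in sequentially. 0 < v n"
    and "0 < a" "0 < b"
    and bound: "\<And>q p. q \<in> \<rat> \<Longrightarrow> p \<in> \<rat> \<Longrightarrow> 0 < q \<Longrightarrow> q < p \<Longrightarrow>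
      \<forall>\<^sub>F n in sequentially. a * u n \<le> q ^ n \<Longrightarrow> \<forall>\<^sub>F n in sequentially. b * v n \<le> p ^ n"
  shows "y \<le> x"
proof (rule ccontr)
  assume "\<not> y \<le> x"
  have "0 \<le> x"
    by (rule tendsto_lowerbound[OF u]) auto
  have "x < y" using \<open>\<not> y \<le> x\<close> by simp
  then obtain c' where c': "x < c'" "c' < y" using dense by blast
  then obtain r' where r': "c' < r'" "r' < y" using dense by blast
  from c' r' \<open>0 \<le> x\<close> obtain c r where cr: "c' = ereal c" "r' = ereal r"
    by (cases c'; cases r') auto
  have "0 < c" "c < r"
    using order.strict_trans1[OF \<open>0 \<le> x\<close> c'(1)] r'(1) by (simp_all add: cr)
  obtain q where q: "q \<in> \<rat>" "c < q" "q < r"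
    using Rats_dense_in_real[OF \<open>c < r\<close>] by blast
  obtain p where p: "p \<in> \<rat>" "q < p" "p < r"
    using Rats_dense_in_real[OF \<open>q < r\<close>] by blast
  have power: "(w powr (1 / real n)) ^ n = w" if "0 < w" "0 < n" for w :: real and n
    using that by (simp add: powr_realpow[symmetric] powr_powr)
  have "\<forall>\<^sub>F n in sequentially. u n powr (1 / real n) < c"
    using order_tendstoD(2)[OF u c'(1)] by (simp add: cr)
  then have "\<forall>\<^sub>F n in sequentially. u n \<le> c ^ n"
    using pos(1) eventually_gt_at_top[of 0]
    by eventually_elim (metis power less_imp_le power_mono powr_ge_zero)
  then have "\<forall>\<^sub>F n in sequentially. a * u n \<le> q ^ n"
    using eventually_scaled_power_le[OF less_imp_le[OF \<open>0 < c\<close>] \<open>c < q\<close>, of a]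
    by eventually_elim (use \<open>0 < a\<close> in \<open>auto intro: order_trans[OF mult_left_mono]\<close>)
  from bound[OF q(1) p(1) _ p(2) this]
  have upper: "\<forall>\<^sub>F n in sequentially. b * v n \<le> p ^ n"
    using q \<open>0 < c\<close> by linarith
  have "\<forall>\<^sub>F n in sequentially. r < v n powr (1 / real n)"
    using order_tendstoD(1)[OF v r'(2)] by (simp add: cr)
  then have "\<forall>\<^sub>F n in sequentially. r ^ n \<le> v n"
    using pos(2) eventually_gt_at_top[of 0]
    by eventually_elim (metis power less_imp_le power_mono \<open>0 < c\<close> \<open>c < r\<close> less_trans)
  \<comment> \<open>The factor 2 turns the weak inequality of the growth comparison into a strict one.\<close>
  moreover have "\<forall>\<^sub>F n in sequentially. (2 / b) * p ^ n \<le> r ^ n"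
    using p q \<open>0 < c\<close> by (intro eventually_scaled_power_le) auto
  ultimately have "\<forall>\<^sub>F n in sequentially. False"
    using upper
  proof eventually_elim
    case (elim n)
    have "2 / b * p ^ n \<le> v n" using elim by linarith
    then have "2 * p ^ n \<le> b * v n" using \<open>0 < b\<close> by (simp add: field_simps)
    moreover have "0 < p ^ n" using p q \<open>0 < c\<close> by simp
    ultimately show False using elim by linarith
  qed
  then show False by simp
qed

theorem theorem3p1:
  fixes M :: "'a measure" and k :: time_kind and F :: "real \<Rightarrow> 'a measure"
    and P f z :: "real \<Rightarrow> real \<Rightarrow> 'a \<Rightarrow> real"
    and x\<^sub>L z\<^sub>L :: "real \<Rightarrow> 'a \<Rightarrow> ereal"
    and s t :: real
  assumes "zero_coupon_bond_market M k F P f z"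
    and "arbitrage_free M k F P"
    and "s \<in> time_set k" and "t \<in> time_set k" and "s \<le> t"
    and "almost_sure_limit M k (\<lambda>T \<omega>. P t T \<omega> powr (1 / T)) (x\<^sub>L t)"
    and "almost_sure_limit M k (\<lambda>T \<omega>. P s T \<omega> powr (1 / T)) (x\<^sub>L s)"
    and "almost_sure_limit M k (z t) (z\<^sub>L t)"
    and "z\<^sub>L t \<in> borel_measurable M" and "AE \<omega> in M. \<bar>z\<^sub>L t \<omega>\<bar> \<noteq> \<infinity>"
    and "almost_sure_limit M k (z s) (z\<^sub>L s)"
    and "z\<^sub>L s \<in> borel_measurable M" and "AE \<omega> in M. \<bar>z\<^sub>L s \<omega>\<bar> \<noteq> \<infinity>"
  shows "AE \<omega> in M. x\<^sub>L s \<omega> \<ge> x\<^sub>L t \<omega>"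
proof -
  interpret zero_coupon_bond_market M k F P f z by fact
  define I where "I = time_set k"
  have I: "s \<in> I" "t \<in> I" "real n \<in> I" for n
    using assms(3,4) by (cases k; simp add: I_def)+
  have "0 \<le> s" using I(1) by (cases k) (auto simp: I_def Nats_def)
  obtain Q R where Q: "prob_space Q" "sets Q = sets M"
    and B_pos: "\<And>u \<omega>. u \<in> I \<Longrightarrow> \<omega> \<in> space M \<Longrightarrow> 0 < bank_account k R u \<omega>"
    and equiv: "locally_equivalent I F Q M"
    and mart: "\<And>T. T \<in> I \<Longrightarrow> martingale_on Q (I \<inter> {0..T}) F
      (\<lambda>u \<omega>. inverse (bank_account k R u \<omega>) * P u T \<omega>)"
    using assms(2) unfolding arbitrage_free_def Let_def I_def by blast
  define B where "B = bank_account k R"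
  define D where "D u n \<omega> = inverse (B u \<omega>) * P u (real n) \<omega>" for u n \<omega>
  have space_Q: "space Q = space M"
    using Q(2) by (rule sets_eq_imp_space_eq)
  have sub_M: "subalgebra M (F u)" if "u \<in> I" for u
    using filtration that by (simp add: filtration_on_def I_def)
  then have sub_Q: "subalgebra Q (F u)" if "u \<in> I" for u
    using that by (simp add: subalgebra_def space_Q Q(2))
  have F_mono: "subalgebra (F t) (F s)"
    using filtration sub_M[of s] sub_M[of t] I \<open>s \<le> t\<close>
    by (auto simp: filtration_on_def I_def subalgebra_def)
  obtain m where m: "t \<le> real m" using real_arch_simple by blast
  have D_mart: "martingale_on Q (I \<inter> {0..real n}) F (\<lambda>u. D u n)" for n
    using mart[OF I(3)] unfolding D_def B_def by simp
  have D_meas: "D u n \<in> borel_measurable (F u)"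
    and D_int: "integrable Q (D u n)"
    if "u \<in> I" "0 \<le> u" "u \<le> real n" for u n
    using D_mart[of n] that by (auto simp: martingale_on_def adapted_on_def)
  have D_nonneg: "0 \<le> D t n \<omega>" if "n \<ge> m" "\<omega> \<in> space M" for n \<omega>
  proof -
    have "t \<le> real n" using m that(1) by linarith
    then show ?thesis
      using that price_pos[of "real n" t \<omega>] B_pos[of t \<omega>] I
      by (simp add: D_def B_def I_def less_imp_le)
  qed
  interpret Q: prob_space Q by fact
  interpret Qs: finite_measure_subalgebra Q "F s"
    by unfold_locales (rule sub_Q[OF I(1)])
  have growth: "AE \<omega> in M. (\<forall>n\<ge>N. D s n \<omega> \<le> q ^ n) \<longrightarrow>
      (\<forall>\<^sub>F n in sequentially. D t n \<omega> \<le> p ^ n)"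
    if N: "N \<ge> m" and pq: "0 < q" "q < p" for N p q
  proof (rule AE_transfer_locally_equivalent[OF equiv I(2) sub_Q[OF I(2)] sub_M[OF I(2)]])
    have late: "s \<le> real n" "t \<le> real n" if "n \<ge> N" for n
      using m N that \<open>s \<le> t\<close> by linarith+
    have Ds: "D s n \<in> borel_measurable (F s)" if "n \<ge> N" for n
      using D_meas[OF I(1) \<open>0 \<le> s\<close>] late that by simp
    have Dt: "D t n \<in> borel_measurable (F t)" if "n \<ge> N" for n
      using D_meas[OF I(2)] late that \<open>0 \<le> s\<close> \<open>s \<le> t\<close> by simp
    show "AE \<omega> in Q. (\<forall>n\<ge>N. D s n \<omega> \<le> q ^ n) \<longrightarrow>
        (\<forall>\<^sub>F n in sequentially. D t n \<omega> \<le> p ^ n)"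
    proof (rule Qs.cond_exp_growth_bound[OF _ _ Ds _ pq])
      fix n assume n: "n \<ge> N"
      show "integrable Q (D t n)"
        using D_int[OF I(2)] late n \<open>0 \<le> s\<close> \<open>s \<le> t\<close> by simp
      show "0 \<le> D t n \<omega>" if "\<omega> \<in> space Q" for \<omega>
        using D_nonneg n N that by (simp add: space_Q)
      show "AE \<omega> in Q. real_cond_exp Q (F s) (D t n) \<omega> = D s n \<omega>"
        using D_mart[of n] I late[OF n] \<open>0 \<le> s\<close> \<open>s \<le> t\<close>
        by (auto simp: martingale_on_def)
    qed
    \<comment> \<open>Below \<open>N\<close> the discounted prices need not be measurable at time \<open>t\<close>; the event involves
        only later maturities.\<close>
    have *: "(\<forall>\<^sub>F n in sequentially. D t n \<omega> \<le> p ^ n) \<longleftrightarrow>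
        (\<forall>\<^sub>F n in sequentially. D t (n + N) \<omega> \<le> p ^ (n + N))" for \<omega>
      by (rule eventually_sequentially_seg[symmetric])
    have **: "(\<forall>n\<ge>N. D s n \<omega> \<le> q ^ n) \<longleftrightarrow> (\<forall>n. D s (n + N) \<omega> \<le> q ^ (n + N))" for \<omega>
      by (metis le_add2 le_add_diff_inverse2)
    have [measurable]: "D s (n + N) \<in> borel_measurable (F t)"
        "D t (n + N) \<in> borel_measurable (F t)" for n
      using measurable_from_subalg[OF F_mono Ds] Dt by simp_all
    show "Measurable.pred (F t) (\<lambda>\<omega>. (\<forall>n\<ge>N. D s n \<omega> \<le> q ^ n) \<longrightarrow>
        (\<forall>\<^sub>F n in sequentially. D t n \<omega> \<le> p ^ n))"
      unfolding * ** eventually_sequentially by measurable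
  qed
  have "AE \<omega> in M. \<forall>N\<in>{m..}. \<forall>q\<in>\<rat>. \<forall>p\<in>\<rat>. 0 < q \<longrightarrow> q < p \<longrightarrow>
      (\<forall>n\<ge>N. D s n \<omega> \<le> q ^ n) \<longrightarrow> (\<forall>\<^sub>F n in sequentially. D t n \<omega> \<le> p ^ n)"
    using growth by (simp add: AE_ball_countable countable_rat)
  with assms(6,7) AE_space show ?thesis
    unfolding almost_sure_limit_def
  proof eventually_elim
    case (elim \<omega>)
    note lim = elim(1,2)[THEN filterlim_compose, OF filterlim_real_maturities_to_infinity]
    have P_pos: "\<forall>\<^sub>F n in sequentially. 0 < P u (real n) \<omega>" if "u \<in> I" "u \<le> t" for u
      using eventually_ge_at_top[of m]
    proof eventually_elim
      case n: (elim n)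
      then have "u \<le> real n" using m that by linarith
      then show ?case using price_pos elim(3) I that by (simp add: I_def)
    qed
    show ?case
    proof (rule growth_rate_le[OF lim(2,1)])
      fix q p :: real
      assume qp: "q \<in> \<rat>" "p \<in> \<rat>" "0 < q" "q < p"
        and "\<forall>\<^sub>F n in sequentially. inverse (B s \<omega>) * P s (real n) \<omega> \<le> q ^ n"
      then obtain N where "\<forall>n\<ge>N. D s n \<omega> \<le> q ^ n"
        by (auto simp: D_def eventually_sequentially)
      then have "\<forall>n\<ge>max m N. D s n \<omega> \<le> q ^ n" by simp
      moreover have "max m N \<in> {m..}" by simp
      ultimately show "\<forall>\<^sub>F n in sequentially. inverse (B t \<omega>) * P t (real n) \<omega> \<le> p ^ n"
        using elim(4) qp unfolding D_def by blast
    qed (use P_pos I \<open>s \<le> t\<close> B_pos elim(3) in \<open>auto simp: B_def\<close>)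
  qed
qed

end
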